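(* Suppose $(X,\sigma)$ is a minimal shift for which there exists $k\in\mathbb{N}$ satisfying $$\liminf_{n\to\infty}\frac{P_X(n)}{n}<k.$$ Then $\mathrm{Aut}(X)/\langle\sigma\rangle$ is finite and $|\mathrm{Aut}(X)/\langle\sigma\rangle|<k$.
   Context: Let $\mathcal{A}$ be a finite alphabet with the discrete topology, give $\mathcal{A}^{\mathbb{Z}}$ the product topology, and let $\sigma\colon\mathcal{A}^{\mathbb{Z}}\to\mathcal{A}^{\mathbb{Z}}$ be the left shift $(\sigma x)(n)=x(n+1)$. A shift $(X,\sigma)$ is a closed, $\sigma$-invariant set $X\subseteq\mathcal{A}^{\mathbb{Z}}$ together with $\sigma$. The orbit of $x\in X$ is $\mathcal{O}(x)=\{\sigma^n x: n\in\mathbb{N}\}$, and the shift is minimal if the orbit of every $x\in X$ is dense in $X$. $\mathrm{Aut}(X)$ is the group of homeomorphisms of $X$ to itself that commute with $\sigma$, and $\langle\sigma\rangle$ is its subgroup generated by $\sigma$. The complexity function $P_X(n)$ is the number of words $w=(a_0,\dots,a_{n-1})\in\mathcal{A}^n$ for which there is $x\in X$ with $x(i)=a_i$ for all $0\le i<n$.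
   Formalization: For k = 1 the shift X is additionally assumed infinite: if X is finite, e.g. one constant sequence, then liminf P_X(n)/n = 0 < 1 but Aut(X)/⟨σ⟩ has order 1, so the claim as stated fails. *)

theory Defs
  imports "HOL-Analysis.Analysis" "HOL-Algebra.Bij" "HOL-Algebra.Generated_Groups"
begin

text \<open>
  The alphabet is a type of sort \<open>{finite, discrete_topology}\<close>; bi-infinite sequences are
  functions \<open>int \<Rightarrow> 'a\<close>, whose library topology is the product topology.
\<close>

definition shift_map :: "(int \<Rightarrow> 'a) \<Rightarrow> int \<Rightarrow> 'a"
  where "shift_map x = (\<lambda>n. x (n + 1))"

text \<open>Invariance is \<open>\<sigma>(X) = X\<close>, so that the left shift is itself an automorphism of \<open>X\<close>.\<close>

definition is_shift :: "(int \<Rightarrow> 'a::{finite,discrete_topology}) set \<Rightarrow> bool"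
  where "is_shift X \<longleftrightarrow> closed X \<and> shift_map ` X = X"

definition orbit :: "(int \<Rightarrow> 'a) \<Rightarrow> (int \<Rightarrow> 'a) set"
  where "orbit x = {(shift_map ^^ n) x | n :: nat. True}"

definition minimal_shift :: "(int \<Rightarrow> 'a::{finite,discrete_topology}) set \<Rightarrow> bool"
  where "minimal_shift X \<longleftrightarrow> is_shift X \<and> (\<forall>x\<in>X. X \<subseteq> closure (orbit x))"

definition complexity :: "(int \<Rightarrow> 'a) set \<Rightarrow> nat \<Rightarrow> nat"
  where "complexity X n = card {w :: 'a list. length w = n \<and> (\<exists>x\<in>X. \<forall>i<n. x (int i) = w ! i)}"

text \<open>
  As in \<^const>\<open>BijGroup\<close>, maps are required to be \<^const>\<open>extensional\<close>, so that each
  self-map of \<open>X\<close> has exactly one representative; the group operation is composition on \<open>X\<close>.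
\<close>

definition Aut :: "(int \<Rightarrow> 'a::{finite,discrete_topology}) set
    \<Rightarrow> ((int \<Rightarrow> 'a) \<Rightarrow> (int \<Rightarrow> 'a)) monoid"
  where "Aut X = (BijGroup X)\<lparr>carrier :=
    {f \<in> extensional X. (\<exists>g. homeomorphism X X f g) \<and>
      (\<forall>x\<in>X. f (shift_map x) = shift_map (f x))}\<rparr>"

definition shift_subgroup :: "(int \<Rightarrow> 'a::{finite,discrete_topology}) set
    \<Rightarrow> ((int \<Rightarrow> 'a) \<Rightarrow> (int \<Rightarrow> 'a)) set"
  where "shift_subgroup X = generate (Aut X) {restrict shift_map X}"

lemma carrier_Aut:
  "carrier (Aut X) = {f \<in> extensional X. (\<exists>g. homeomorphism X X f g) \<and>
      (\<forall>x\<in>X. f (shift_map x) = shift_map (f x))}"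
  by (simp add: Aut_def)

lemma carrier_Aut_subset_Bij: "carrier (Aut X) \<subseteq> Bij X"
proof
  fix f assume "f \<in> carrier (Aut X)"
  then obtain g where "f \<in> extensional X" and g: "homeomorphism X X f g"
    by (auto simp: carrier_Aut)
  moreover have "bij_betw f X X"
    using g by (intro bij_betw_byWitness[of X g]) (auto simp: homeomorphism_def)
  ultimately show "f \<in> Bij X"
    by (simp add: Bij_def)
qed

lemma mult_Aut:
  assumes "f \<in> carrier (Aut X)" "g \<in> carrier (Aut X)"
  shows "f \<otimes>\<^bsub>Aut X\<^esub> g = compose X f g"
  using assms carrier_Aut_subset_Bij[of X] by (auto simp: Aut_def BijGroup_def)

lemma one_Aut: "\<one>\<^bsub>Aut X\<^esub> = (\<lambda>x\<in>X. x)"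
  by (simp add: Aut_def BijGroup_def)

lemma shift_map_in: "is_shift X \<Longrightarrow> x \<in> X \<Longrightarrow> shift_map x \<in> X"
  by (auto simp: is_shift_def)

lemma group_Aut:
  assumes "is_shift X"
  shows "group (Aut X)"
proof (rule groupI)
  fix f g assume fg: "f \<in> carrier (Aut X)" "g \<in> carrier (Aut X)"
  then obtain f' g' where h: "homeomorphism X X f f'" "homeomorphism X X g g'"
    by (auto simp: carrier_Aut)
  have gX: "g x \<in> X" if "x \<in> X" for x
    using h(2) that by (auto simp: homeomorphism_def)
  have "homeomorphism X X (f \<circ> g) (g' \<circ> f')"
    using homeomorphism_compose[OF h(2) h(1)] .
  then have "homeomorphism X X (compose X f g) (g' \<circ> f')"
    by (rule homeomorphism_cong) (auto simp: compose_def)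
  moreover have "compose X f g (shift_map x) = shift_map (compose X f g x)" if "x \<in> X" for x
    using fg that shift_map_in[OF assms that] gX[OF that] by (simp add: carrier_Aut compose_eq)
  ultimately show "f \<otimes>\<^bsub>Aut X\<^esub> g \<in> carrier (Aut X)"
    unfolding mult_Aut[OF fg] by (auto simp: carrier_Aut)
next
  have "homeomorphism X X (\<lambda>x\<in>X. x) id"
    by (rule homeomorphism_cong[OF homeomorphism_ident[of X]]) auto
  then show "\<one>\<^bsub>Aut X\<^esub> \<in> carrier (Aut X)"
    using shift_map_in[OF assms] by (auto simp: one_Aut carrier_Aut)
next
  fix f g h assume "f \<in> carrier (Aut X)" "g \<in> carrier (Aut X)" "h \<in> carrier (Aut X)"
  then have "f \<in> carrier (BijGroup X)" "g \<in> carrier (BijGroup X)" "h \<in> carrier (BijGroup X)"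
    using carrier_Aut_subset_Bij[of X] by (auto simp: BijGroup_def)
  then have "f \<otimes>\<^bsub>BijGroup X\<^esub> g \<otimes>\<^bsub>BijGroup X\<^esub> h = f \<otimes>\<^bsub>BijGroup X\<^esub> (g \<otimes>\<^bsub>BijGroup X\<^esub> h)"
    by (rule monoid.m_assoc[OF group.is_monoid[OF group_BijGroup]])
  then show "f \<otimes>\<^bsub>Aut X\<^esub> g \<otimes>\<^bsub>Aut X\<^esub> h = f \<otimes>\<^bsub>Aut X\<^esub> (g \<otimes>\<^bsub>Aut X\<^esub> h)"
    by (simp add: Aut_def)
next
  fix f assume "f \<in> carrier (Aut X)"
  then have "f \<in> carrier (BijGroup X)"
    using carrier_Aut_subset_Bij[of X] by (auto simp: BijGroup_def)
  then have "\<one>\<^bsub>BijGroup X\<^esub> \<otimes>\<^bsub>BijGroup X\<^esub> f = f"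
    by (rule monoid.l_one[OF group.is_monoid[OF group_BijGroup]])
  then show "\<one>\<^bsub>Aut X\<^esub> \<otimes>\<^bsub>Aut X\<^esub> f = f"
    by (simp add: Aut_def)
next
  fix f assume f: "f \<in> carrier (Aut X)"
  then obtain g where g: "homeomorphism X X f g" and fe: "f \<in> extensional X"
    and comm: "\<And>x. x \<in> X \<Longrightarrow> f (shift_map x) = shift_map (f x)"
    by (auto simp: carrier_Aut)
  have gX: "g x \<in> X" "f (g x) = x" and fX: "f x \<in> X" "g (f x) = x" if "x \<in> X" for x
    using g that by (auto simp: homeomorphism_def)
  have "homeomorphism X X (restrict g X) f"
    by (rule homeomorphism_cong[OF homeomorphism_symD[OF g]]) auto
  moreover have "g (shift_map x) = shift_map (g x)" if "x \<in> X" for x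
  proof -
    have "g (shift_map (f (g x))) = g (f (shift_map (g x)))"
      using comm gX(1)[OF that] by simp
    then show ?thesis
      using that gX fX shift_map_in[OF assms] by simp
  qed
  ultimately have gA: "restrict g X \<in> carrier (Aut X)"
    using gX(1) shift_map_in[OF assms] by (auto simp: carrier_Aut)
  have "restrict g X \<otimes>\<^bsub>Aut X\<^esub> f = \<one>\<^bsub>Aut X\<^esub>"
    unfolding mult_Aut[OF gA f] one_Aut using fX by (auto simp: compose_def fun_eq_iff)
  then show "\<exists>y\<in>carrier (Aut X). y \<otimes>\<^bsub>Aut X\<^esub> f = \<one>\<^bsub>Aut X\<^esub>"
    using gA by blast
qed

lemma shift_map_Aut:
  assumes "is_shift X"
  shows "restrict shift_map X \<in> carrier (Aut X)"
proof -
  define g :: "(int \<Rightarrow> 'a) \<Rightarrow> int \<Rightarrow> 'a" where "g = (\<lambda>x n. x (n - 1))"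
  have gs: "g (shift_map x) = x" "shift_map (g x) = x" for x
    by (auto simp: g_def shift_map_def)
  have X: "shift_map ` X = X"
    using assms by (simp add: is_shift_def)
  have gX: "g ` X = X"
    using arg_cong[OF X, of "image g"] by (simp add: image_image gs)
  have cont: "continuous_on X (\<lambda>x :: int \<Rightarrow> 'a. (\<lambda>n. x (h n)))" for h :: "int \<Rightarrow> int"
    by (intro continuous_on_coordinatewise_then_product
          continuous_on_subset[OF continuous_on_product_coordinates]) auto
  have "homeomorphism X X shift_map g"
    using cont[of "\<lambda>n. n + 1"] cont[of "\<lambda>n. n - 1"] X gX gs
    by (auto simp: homeomorphism_def shift_map_def[abs_def] g_def[abs_def])
  then have "homeomorphism X X (restrict shift_map X) g"
    by (rule homeomorphism_cong) auto
  then show ?thesis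
    using shift_map_in[OF assms] by (auto simp: carrier_Aut)
qed

lemma shift_subgroup_normal:
  assumes "is_shift X"
  shows "shift_subgroup X \<lhd> Aut X"
proof -
  interpret group "Aut X" by (rule group_Aut[OF assms])
  let ?s = "restrict shift_map X"
  have s: "?s \<in> carrier (Aut X)" by (rule shift_map_Aut[OF assms])
  have "f \<otimes>\<^bsub>Aut X\<^esub> ?s \<otimes>\<^bsub>Aut X\<^esub> inv\<^bsub>Aut X\<^esub> f = ?s" if f: "f \<in> carrier (Aut X)" for f
  proof -
    have fX: "f x \<in> X" if "x \<in> X" for x
      using f that by (auto simp: carrier_Aut homeomorphism_def)
    have "f \<otimes>\<^bsub>Aut X\<^esub> ?s = ?s \<otimes>\<^bsub>Aut X\<^esub> f"
      unfolding mult_Aut[OF f s] mult_Aut[OF s f]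
      using f fX by (auto simp: carrier_Aut compose_def fun_eq_iff)
    then show ?thesis
      using f s by (simp add: m_assoc)
  qed
  then show ?thesis
    unfolding shift_subgroup_def using s by (intro normal_generateI) auto
qed

end

theory Submission
  imports Defs
begin

text \<open>
  If \<open>P(n+1) - P(n) < k\<close>, then fewer than \<open>k\<close> words of length \<open>n\<close> have two right extensions, and
  the hypothesis on the lower limit gives infinitely many such \<open>n\<close>. An infinite \<open>X\<close> contains
  points \<open>x \<noteq> y\<close> that agree on a left half-line, and every automorphism \<open>f\<close> maps them to another
  such pair. The words of \<open>f x\<close> ending just before the first difference of \<open>f x\<close> and \<open>f y\<close> have two
  right extensions, so among \<open>k\<close> automorphisms two produce the same words for all lengths. Up to
  a power of the shift these two agree at \<open>x\<close> on a left half-line, and by minimality they agree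
  everywhere up to that power. If \<open>X\<close> is finite, it is a single periodic orbit and every
  automorphism is a power of the shift.
\<close>

section \<open>Words and complexity\<close>

text \<open>Exponents are integers, so that inverse shifts and the offset between two maps are of
  the same form.\<close>

definition shift_by :: "int \<Rightarrow> (int \<Rightarrow> 'a) \<Rightarrow> int \<Rightarrow> 'a"
  where "shift_by m x = (\<lambda>n. x (n + m))"

definition word :: "int \<Rightarrow> nat \<Rightarrow> (int \<Rightarrow> 'a) \<Rightarrow> 'a list"
  where "word m n x = map (\<lambda>i. x (m + int i)) [0..<n]"

definition language :: "(int \<Rightarrow> 'a) set \<Rightarrow> nat \<Rightarrow> 'a list set"
  where "language X n = word 0 n ` X"

definition right_special :: "(int \<Rightarrow> 'a) set \<Rightarrow> nat \<Rightarrow> 'a list set"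
  where "right_special X n =
    {w. \<exists>a b. a \<noteq> b \<and> w @ [a] \<in> language X (Suc n) \<and> w @ [b] \<in> language X (Suc n)}"

lemma shift_by_0 [simp]: "shift_by 0 x = x"
  by (simp add: shift_by_def)

lemma shift_by_shift_by [simp]: "shift_by m (shift_by n x) = shift_by (m + n) x"
  by (simp add: shift_by_def add.assoc)

lemma shift_map_eq_shift_by: "shift_map = shift_by 1"
  by (simp add: shift_by_def shift_map_def fun_eq_iff)

lemma funpow_shift_map: "(shift_map ^^ n) x = shift_by (int n) x"
  by (induction n) (simp_all add: shift_map_eq_shift_by add.commute)

lemma shift_by_in:
  assumes X: "is_shift X" and x: "x \<in> X"
  shows "shift_by m x \<in> X"
proof -
  have eq: "shift_by 1 ` X = X"
    using X by (simp add: is_shift_def shift_map_eq_shift_by)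
  \<comment> \<open>Surjectivity of the shift on \<open>X\<close> provides the preimage
    \<open>z\<close>, and \<open>shift_by (-1)\<close> recovers it from \<open>y\<close>.\<close>
  have neg: "shift_by (-1) y \<in> X" if "y \<in> X" for y
  proof -
    obtain z where "z \<in> X" "y = shift_by 1 z"
      using eq \<open>y \<in> X\<close> by blast
    then show ?thesis by simp
  qed
  show ?thesis
  proof (induction m rule: int_induct[where k = 0])
    case (step1 i)
    then have "shift_by 1 (shift_by i x) \<in> X" using eq by blast
    then show ?case by (simp add: add.commute)
  next
    case (step2 i)
    then show ?case using neg[of "shift_by i x"] by simp
  qed (use x in simp)
qed

lemma length_word [simp]: "length (word m n x) = n"
  by (simp add: word_def)

lemma word_eq_iff: "word m n x = word m' n y \<longleftrightarrow> (\<forall>i<n. x (m + int i) = y (m' + int i))"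
  by (auto simp: word_def)

lemma word_Suc: "word m (Suc n) x = word m n x @ [x (m + int n)]"
  by (simp add: word_def)

lemma word_in_language:
  assumes "is_shift X" "x \<in> X"
  shows "word m n x \<in> language X n"
proof -
  have "word m n x = word 0 n (shift_by m x)"
    by (simp add: word_eq_iff shift_by_def add.commute)
  then show ?thesis
    using shift_by_in[OF assms] by (auto simp: language_def)
qed

lemma complexity_eq_card_language: "complexity X n = card (language X n)"
proof -
  have "(length w = n \<and> (\<forall>i<n. x (int i) = w ! i)) \<longleftrightarrow> w = word 0 n x" for w and x :: "int \<Rightarrow> 'a"
    unfolding list_eq_iff_nth_eq[of w] word_def by auto
  then have "{w. length w = n \<and> (\<exists>x\<in>X. \<forall>i<n. x (int i) = w ! i)} = language X n"
    unfolding language_def by blast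
  then show ?thesis by (simp add: complexity_def)
qed

lemma finite_language: "finite (language (X :: (int \<Rightarrow> 'a::finite) set) n)"
  by (rule finite_subset[OF _ finite_lists_length_eq[OF finite[of UNIV], of n]])
     (auto simp: language_def)

section \<open>Right special words\<close>

lemma language_butlast: "w @ [a] \<in> language X (Suc n) \<Longrightarrow> w \<in> language X n"
  by (auto simp: language_def word_Suc)

lemma right_special_subset: "right_special X n \<subseteq> language X n"
  by (auto simp: right_special_def dest: language_butlast)

text \<open>Every word of length \<open>n\<close> has a right extension by some \<open>e w\<close>,
  and a right special one has a second, by \<open>e' w\<close>. All these words of length
  \<open>Suc n\<close> are distinct.\<close>

lemma card_right_special:
  fixes X :: "(int \<Rightarrow> 'a::finite) set"
  shows "card (right_special X n) + complexity X n \<le> complexity X (Suc n)"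
proof -
  let ?L = "language X n" and ?R = "right_special X n"
  have "\<exists>a. w @ [a] \<in> language X (Suc n)" if "w \<in> ?L" for w
    using that by (auto simp: language_def word_Suc image_iff)
  then obtain e where e: "\<And>w. w \<in> ?L \<Longrightarrow> w @ [e w] \<in> language X (Suc n)"
    by metis
  have "\<exists>a. a \<noteq> e w \<and> w @ [a] \<in> language X (Suc n)" if "w \<in> ?R" for w
    using that unfolding right_special_def by (auto, metis)
  then obtain e' where e': "\<And>w. w \<in> ?R \<Longrightarrow> e' w \<noteq> e w"
      "\<And>w. w \<in> ?R \<Longrightarrow> w @ [e' w] \<in> language X (Suc n)"
    by metis
  have "card ?R + card ?L = card ((\<lambda>w. w @ [e' w]) ` ?R) + card ((\<lambda>w. w @ [e w]) ` ?L)"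
    by (simp add: card_image inj_on_def)
  also have "\<dots> = card ((\<lambda>w. w @ [e' w]) ` ?R \<union> (\<lambda>w. w @ [e w]) ` ?L)"
    using finite_language[of X n] finite_subset[OF right_special_subset finite_language, of X n] e'(1)
    by (intro card_Un_disjoint[symmetric]) auto
  also have "\<dots> \<le> card (language X (Suc n))"
    by (rule card_mono[OF finite_language]) (use e e'(2) in auto)
  finally show ?thesis by (simp add: complexity_eq_card_language)
qed

text \<open>The window ends at position \<open>m - 1\<close>, so it is common to both points, and
  their letters at \<open>m\<close> extend it in two ways.\<close>

lemma right_specialI:
  assumes "is_shift X" "x \<in> X" "y \<in> X"
    and "\<And>i. i < m \<Longrightarrow> x i = y i" "x m \<noteq> y m"
  shows "word (m - int n) n x \<in> right_special X n"
proof -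
  have "word (m - int n) n x = word (m - int n) n y"
    using assms(4) by (simp add: word_eq_iff)
  then show ?thesis
    using word_in_language[OF assms(1,2), of "m - int n" "Suc n"]
      word_in_language[OF assms(1,3), of "m - int n" "Suc n"] assms(5)
    by (auto simp: right_special_def word_Suc)
qed

section \<open>Increments of the complexity\<close>

text \<open>Increments of at least \<open>k\<close> from \<open>N\<close> on would make
  \<open>P n\<close> at least \<open>k * (n - N)\<close>, and the lower limit of the quotient at
  least \<open>k\<close>.\<close>

lemma liminf_quotient_less_imp_increment_less:
  fixes P :: "nat \<Rightarrow> nat"
  assumes "liminf (\<lambda>n. ereal (real (P n) / real n)) < ereal (real k)"
  shows "\<exists>n\<ge>N. P (Suc n) < P n + k"
proof (rule ccontr)
  assume "\<not> ?thesis"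
  then have incr: "P n + k \<le> P (Suc n)" if "n \<ge> N" for n
    using that by force
  have lower: "k * (n - N) \<le> P n" if "n \<ge> N" for n
    using that
  proof (induction n rule: dec_induct)
    case (step n)
    then show ?case using incr[of n] by (simp add: Suc_diff_le)
  qed simp
  have "eventually (\<lambda>n. ereal (real k - real k * real N / real n) \<le> ereal (real (P n) / real n)) sequentially"
  \<comment> \<open>Starting at \<open>max N 1\<close> keeps \<open>n\<close> nonzero, so that it
    can be cancelled.\<close>
  proof (rule eventually_sequentiallyI[of "max N 1"])
    fix n assume "max N 1 \<le> n"
    then have n: "n \<ge> N" "n \<ge> 1" by auto
    have "real k * (real n - real N) \<le> real (P n)"
      using lower[OF n(1)] n(1) by (metis of_nat_diff of_nat_le_iff of_nat_mult)
    then have "real k * (real n - real N) / real n \<le> real (P n) / real n"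
      by (rule divide_right_mono) simp
    then show "ereal (real k - real k * real N / real n) \<le> ereal (real (P n) / real n)"
      using n(2) by (simp add: right_diff_distrib diff_divide_distrib)
  qed
  then have "liminf (\<lambda>n. ereal (real k - real k * real N / real n))
      \<le> liminf (\<lambda>n. ereal (real (P n) / real n))"
    by (rule Liminf_mono)
  moreover have "(\<lambda>n. real k - real k * real N / real n) \<longlonglongrightarrow> real k - 0"
    by (intro tendsto_intros lim_const_over_n)
  then have "(\<lambda>n. ereal (real k - real k * real N / real n)) \<longlonglongrightarrow> ereal (real k)"
    by simp
  then have "liminf (\<lambda>n. ereal (real k - real k * real N / real n)) = ereal (real k)"
    by (intro lim_imp_Liminf) simp_all
  ultimately show False using assms by simp
qed

section \<open>Compactness\<close>

text \<open>Cantor's intersection theorem: finitely many members of a decreasing sequence meet in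
  the one of largest index.\<close>

lemma compact_decseq_Inter_nonempty:
  fixes C :: "nat \<Rightarrow> 'a::topological_space set"
  assumes "compact K" "\<And>n. closed (C n)" "\<And>n. K \<inter> C n \<noteq> {}" "decseq C"
  shows "K \<inter> (\<Inter>n. C n) \<noteq> {}"
proof (rule compact_imp_fip_image[OF assms(1)])
  fix I :: "nat set" assume "finite I"
  have "C (Max (insert 0 I)) \<subseteq> C i" if "i \<in> I" for i
    using \<open>finite I\<close> that by (intro decseqD[OF assms(4)] Max_ge) auto
  then show "K \<inter> (\<Inter>i\<in>I. C i) \<noteq> {}"
    using assms(3)[of "Max (insert 0 I)"] by blast
qed (use assms(2) in auto)

text \<open>Tychonoff's theorem; every factor is compact because it is finite.\<close>

lemma compact_UNIV_fun: "compact (UNIV :: ('i \<Rightarrow> 'a::{finite,topological_space}) set)"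
proof -
  have "compactin (product_topology (\<lambda>i::'i. euclidean :: 'a topology) UNIV) (\<Pi>\<^sub>E i\<in>UNIV. UNIV)"
    unfolding compactin_PiE by (simp add: finite_imp_compact)
  then show ?thesis by (simp add: euclidean_product_topology)
qed

lemma is_shift_compact: "is_shift X \<Longrightarrow> compact X"
  using closed_Int_compact[OF _ compact_UNIV_fun, of X] by (simp add: is_shift_def)

lemma is_shift_closed: "is_shift X \<Longrightarrow> closed X"
  by (simp add: is_shift_def)

text \<open>Every subset of a finite T1 space is closed, so any condition on the value is closed,
  even that two values differ.\<close>

lemma closed_Collect_finite_valued:
  fixes f :: "'a::topological_space \<Rightarrow> 'b::{finite,t1_space}"
  assumes "closed X" "continuous_on X f"
  shows "closed {x \<in> X. P (f x)}"
proof -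
  have "closed (X \<inter> f -` {y. P y})"
    using assms by (intro continuous_closed_preimage) (auto intro: finite_imp_closed)
  then show ?thesis
    by (simp add: vimage_def Int_def)
qed

lemma continuous_on_coordinate: "continuous_on X (\<lambda>x. x i)"
  by (rule continuous_on_subset[OF continuous_on_product_coordinates]) simp

lemma closed_Collect_agree:
  fixes f g :: "'b::topological_space \<Rightarrow> 'i \<Rightarrow> 'a::{finite,t2_space}"
  assumes "closed X" "continuous_on X f" "continuous_on X g"
  shows "closed {x \<in> X. \<forall>i\<in>I. f x i = g x i}"
proof -
  have "closed {x \<in> X. f x i = g x i}" for i
    using closed_Collect_finite_valued[OF assms(1), of "\<lambda>x. (f x i, g x i)" "\<lambda>(a, b). a = b"]
      assms(2,3) by (simp add: continuous_on_Pair continuous_on_product_then_coordinatewise)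
  then have "closed (X \<inter> (\<Inter>i\<in>I. {x \<in> X. f x i = g x i}))"
    using assms(1) by auto
  moreover have "X \<inter> (\<Inter>i\<in>I. {x \<in> X. f x i = g x i}) = {x \<in> X. \<forall>i\<in>I. f x i = g x i}"
    by auto
  ultimately show ?thesis by simp
qed

lemma finite_imp_closed_fun:
  fixes A :: "('i \<Rightarrow> 'a::{finite,t2_space}) set"
  assumes "finite A"
  shows "closed A"
proof -
  have "closed {a}" for a :: "'i \<Rightarrow> 'a"
    using closed_Collect_agree[OF closed_UNIV continuous_on_id continuous_on_const, of UNIV a]
    by (simp add: fun_eq_iff[symmetric])
  then have "closed (\<Union>a\<in>A. {a})"
    using assms by (intro closed_UN) simp_all
  then show ?thesis by simp
qed

lemma closed_Collect_pairs_agree_differ: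
  fixes X :: "('i \<Rightarrow> 'a::{finite,t2_space}) set" and h :: "('i \<Rightarrow> 'a) \<Rightarrow> 'b::{finite,t2_space}"
  assumes "closed X" "continuous_on X h"
  shows "closed {p \<in> X \<times> X. (\<forall>i\<in>I. fst p i = snd p i) \<and> h (fst p) \<noteq> h (snd p)}"
proof -
  have XX: "closed (X \<times> X)"
    using assms(1) by (simp add: closed_Times)
  have "continuous_on (X \<times> X) (\<lambda>p. h (fst p))" "continuous_on (X \<times> X) (\<lambda>p. h (snd p))"
    by (auto intro: continuous_on_compose2[OF assms(2) continuous_on_fst[OF continuous_on_id]]
        continuous_on_compose2[OF assms(2) continuous_on_snd[OF continuous_on_id]])
  then have "closed {p \<in> X \<times> X. h (fst p) \<noteq> h (snd p)}"
    using closed_Collect_finite_valued[OF XX, of "\<lambda>p. (h (fst p), h (snd p))" "\<lambda>(a, b). a \<noteq> b"]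
    by (simp add: continuous_on_Pair)
  moreover have "closed {p \<in> X \<times> X. \<forall>i\<in>I. fst p i = snd p i}"
    by (intro closed_Collect_agree XX continuous_on_fst continuous_on_snd continuous_on_id)
  ultimately have "closed ({p \<in> X \<times> X. \<forall>i\<in>I. fst p i = snd p i}
      \<inter> {p \<in> X \<times> X. h (fst p) \<noteq> h (snd p)})"
    by (rule closed_Int[rotated])
  moreover have "{p \<in> X \<times> X. \<forall>i\<in>I. fst p i = snd p i} \<inter> {p \<in> X \<times> X. h (fst p) \<noteq> h (snd p)}
      = {p \<in> X \<times> X. (\<forall>i\<in>I. fst p i = snd p i) \<and> h (fst p) \<noteq> h (snd p)}"
    by auto
  ultimately show ?thesis by simp
qed

text \<open>The pairs in question form a decreasing sequence of closed sets in the compact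
  \<open>X \<times> X\<close>. The values under \<open>h\<close> still differ in the limit because
  \<open>h\<close> takes values in a finite space, where this condition is closed.\<close>

lemma pair_agree_differ_limit:
  fixes X :: "('i \<Rightarrow> 'a::{finite,t2_space}) set" and h :: "('i \<Rightarrow> 'a) \<Rightarrow> 'b::{finite,t2_space}"
  assumes X: "compact X" and closed: "closed X" and h: "continuous_on X h" and I: "incseq I"
    and ex: "\<And>n::nat. \<exists>x\<in>X. \<exists>y\<in>X. (\<forall>i\<in>I n. x i = y i) \<and> h x \<noteq> h y"
  shows "\<exists>x\<in>X. \<exists>y\<in>X. (\<forall>i\<in>(\<Union>n. I n). x i = y i) \<and> h x \<noteq> h y"
proof -
  define C where
    "C n = {p \<in> X \<times> X. (\<forall>i\<in>I n. fst p i = snd p i) \<and> h (fst p) \<noteq> h (snd p)}" for n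
  have "X \<times> X \<inter> (\<Inter>n. C n) \<noteq> {}"
  proof (rule compact_decseq_Inter_nonempty)
    show "closed (C n)" for n
      unfolding C_def by (rule closed_Collect_pairs_agree_differ[OF closed h])
    show "decseq C"
      unfolding C_def using I by (intro decseq_SucI) (fastforce dest: incseq_SucD)
    show "X \<times> X \<inter> C n \<noteq> {}" for n
      using ex[of n] by (auto simp: C_def)
  qed (use X in \<open>simp add: compact_Times\<close>)
  then obtain p where "p \<in> (\<Inter>n. C n)" by blast
  then show ?thesis
    by (intro bexI[of _ "fst p"] bexI[of _ "snd p"]) (auto simp: C_def mem_Times_iff)
qed

text \<open>There are only finitely many pairs, so a single bound serves all of them.\<close>

lemma eventually_inj_on:
  assumes "finite S"
    and "\<And>x y. x \<in> S \<Longrightarrow> y \<in> S \<Longrightarrow> x \<noteq> y \<Longrightarrow> eventually (\<lambda>n. w n x \<noteq> w n y) F"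
  shows "eventually (\<lambda>n. inj_on (w n) S) F"
proof -
  have "eventually (\<lambda>n. \<forall>x\<in>S. \<forall>y\<in>S. x \<noteq> y \<longrightarrow> w n x \<noteq> w n y) F"
    using assms by (auto intro!: eventually_ball_finite)
  then show ?thesis
    by (rule eventually_mono) (auto simp: inj_on_def)
qed

section \<open>Asymptotic pairs\<close>

text \<open>If for some \<open>n\<close> the \<open>n\<close> letters before position 0 always
  determined the letter at 0, a word of length \<open>n\<close> would determine everything to its
  right, and \<open>X\<close> would have at most \<open>complexity X n\<close> points. So suitable
  pairs exist for each \<open>n\<close>, and compactness yields a limit pair.\<close>

lemma exists_left_asymptotic_pair:
  fixes X :: "(int \<Rightarrow> 'a::{finite,discrete_topology}) set"
  assumes X: "is_shift X" and inf: "infinite X"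
  shows "\<exists>x\<in>X. \<exists>y\<in>X. (\<forall>i<0. x i = y i) \<and> x 0 \<noteq> y 0"
proof -
  have "\<exists>x\<in>X. \<exists>y\<in>X. (\<forall>i\<in>{- int n..<0}. x i = y i) \<and> x 0 \<noteq> y 0" for n
  proof (rule ccontr)
    assume "\<not> ?thesis"
    then have det: "x 0 = y 0" if "x \<in> X" "y \<in> X" "\<forall>i\<in>{- int n..<0}. x i = y i" for x y
      using that by blast
    \<comment> \<open>Letter by letter, each new position is determined by the \<open>n\<close>
      positions before it.\<close>
    have right: "x (m + int j) = y (m + int j)"
      if xy: "x \<in> X" "y \<in> X" and eq: "word m n x = word m n y" for x y m j
    proof (induction j rule: less_induct)
      case (less j)
      show ?case
      proof (cases "j < n")
        case True
        then show ?thesis using eq by (simp add: word_eq_iff)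
      next
        case False
        have "shift_by (m + int j) x i = shift_by (m + int j) y i" if "i \<in> {- int n..<0}" for i
        proof -
          have "nat (int j + i) < j" "int (nat (int j + i)) = int j + i"
            using that False by auto
          then have "x (m + (int j + i)) = y (m + (int j + i))"
            using less by metis
          then show ?thesis by (simp add: shift_by_def ac_simps)
        qed
        then have "shift_by (m + int j) x 0 = shift_by (m + int j) y 0"
          using det shift_by_in[OF X] xy by blast
        then show ?thesis by (simp add: shift_by_def)
      qed
    qed
    obtain S where S: "S \<subseteq> X" "finite S" "card S = Suc (complexity X n)"
      using infinite_arbitrarily_large[OF inf] by blast
    \<comment> \<open>A window that starts at or to the left of a difference of two points separates
      them, since equal windows force agreement to the right.\<close>
    have "eventually (\<lambda>N. inj_on (word (- int N) n) S) sequentially"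
    proof (rule eventually_inj_on[OF S(2)])
      fix x y assume xy: "x \<in> S" "y \<in> S" "x \<noteq> y"
      then obtain i where i: "x i \<noteq> y i" by auto
      have "word (- int N) n x \<noteq> word (- int N) n y" if "N \<ge> nat \<bar>i\<bar>" for N
      proof
        assume "word (- int N) n x = word (- int N) n y"
        then have "x (- int N + int (nat (i + int N))) = y (- int N + int (nat (i + int N)))"
          using right xy S(1) by blast
        moreover have "- int N + int (nat (i + int N)) = i"
          using that by auto
        ultimately show False using i by metis
      qed
      then show "eventually (\<lambda>N. word (- int N) n x \<noteq> word (- int N) n y) sequentially"
        by (rule eventually_sequentiallyI)
    qed
    then obtain N where "inj_on (word (- int N) n) S"
      using eventually_happens'[OF sequentially_bot] by blast
    moreover have "word (- int N) n ` S \<subseteq> language X n"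
      using word_in_language[OF X] S(1) by blast
    ultimately have "card S \<le> complexity X n"
      unfolding complexity_eq_card_language by (rule card_inj_on_le[OF _ _ finite_language])
    then show False using S(3) by simp
  qed
  then have "\<exists>x\<in>X. \<exists>y\<in>X. (\<forall>i\<in>(\<Union>n. {- int n..<0}). x i = y i) \<and> x 0 \<noteq> y 0"
    by (intro pair_agree_differ_limit is_shift_compact[OF X] is_shift_closed[OF X] continuous_on_coordinate)
       (auto simp: incseq_def)
  moreover have "i \<in> (\<Union>n. {- int n..<0})" if "i < 0" for i
    using that by (intro UN_I[of "nat (- i)"]) auto
  ultimately show ?thesis by meson
qed

section \<open>Continuous maps that commute with the shift\<close>

text \<open>These are the endomorphisms of the shift. Leaving out \<open>extensional\<close> keeps
  the class closed under composition with \<open>shift_by m\<close>.\<close>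

definition equivariant :: "(int \<Rightarrow> 'a::{finite,discrete_topology}) set
    \<Rightarrow> ((int \<Rightarrow> 'a) \<Rightarrow> (int \<Rightarrow> 'a)) \<Rightarrow> bool"
  where "equivariant X f \<longleftrightarrow> continuous_on X f \<and> f ` X \<subseteq> X \<and>
    (\<forall>x\<in>X. f (shift_map x) = shift_map (f x))"

lemma equivariant_shift_by:
  assumes X: "is_shift X" and f: "equivariant X f" and x: "x \<in> X"
  shows "f (shift_by m x) = shift_by m (f x)"
proof -
  have 1: "f (shift_by 1 y) = shift_by 1 (f y)" if "y \<in> X" for y
    using f that by (simp add: equivariant_def shift_map_eq_shift_by)
  show ?thesis
  proof (induction m rule: int_induct[where k = 0])
    case (step1 i)
    then show ?case
      using 1[OF shift_by_in[OF X x, of i]] by (simp add: add.commute)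
  next
    case (step2 i)
    have "shift_by 1 (f (shift_by (i - 1) x)) = shift_by i (f x)"
      using 1[OF shift_by_in[OF X x, of "i - 1"]] step2 by simp
    then have "shift_by (-1) (shift_by 1 (f (shift_by (i - 1) x))) = shift_by (-1) (shift_by i (f x))"
      by simp
    then show ?case by simp
  qed simp
qed

lemma continuous_on_shift_by: "continuous_on A (shift_by m :: (int \<Rightarrow> 'a::topological_space) \<Rightarrow> _)"
  by (rule continuous_on_coordinatewise_then_product)
     (simp add: shift_by_def continuous_on_coordinate)

lemma equivariant_shift_by_comp:
  assumes "is_shift X" "equivariant X f"
  shows "equivariant X (\<lambda>x. shift_by m (f x))"
  unfolding equivariant_def
proof (intro conjI)
  show "continuous_on X (\<lambda>x. shift_by m (f x))"
    using assms(2) unfolding equivariant_def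
    by (intro continuous_on_compose2[OF continuous_on_shift_by[of UNIV]]) auto
  show "(\<lambda>x. shift_by m (f x)) ` X \<subseteq> X"
    using assms(2) shift_by_in[OF assms(1)] unfolding equivariant_def by blast
  show "\<forall>x\<in>X. shift_by m (f (shift_map x)) = shift_map (shift_by m (f x))"
    using assms(2) unfolding equivariant_def shift_map_eq_shift_by by (simp add: add.commute)
qed

text \<open>The locality half of the Curtis-Hedlund-Lyndon theorem: otherwise compactness would give
  two points that agree everywhere and have different images.\<close>

lemma equivariant_local:
  fixes X :: "(int \<Rightarrow> 'a::{finite,discrete_topology}) set"
  assumes X: "is_shift X" and f: "equivariant X f"
  shows "\<exists>R::nat. \<forall>x\<in>X. \<forall>y\<in>X. (\<forall>i\<in>{- int R..int R}. x i = y i) \<longrightarrow> f x 0 = f y 0"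
proof (rule ccontr)
  assume "\<not> ?thesis"
  then have "\<exists>x\<in>X. \<exists>y\<in>X. (\<forall>i\<in>{- int n..int n}. x i = y i) \<and> f x 0 \<noteq> f y 0" for n :: nat
    by blast
  then have "\<exists>x\<in>X. \<exists>y\<in>X. (\<forall>i\<in>(\<Union>n. {- int n..int n}). x i = y i) \<and> f x 0 \<noteq> f y 0"
    using f by (intro pair_agree_differ_limit is_shift_compact[OF X] is_shift_closed[OF X])
      (auto simp: incseq_def equivariant_def continuous_on_product_then_coordinatewise)
  then obtain x y where xy: "\<forall>i\<in>(\<Union>n. {- int n..int n}). x i = y i" "f x 0 \<noteq> f y 0"
    by blast
  have "x = y"
  proof
    fix i
    have "i \<in> (\<Union>n. {- int n..int n})"
      by (intro UN_I[of "nat \<bar>i\<bar>"]) auto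
    then show "x i = y i" using xy(1) by blast
  qed
  with xy(2) show False by simp
qed

text \<open>By locality with radius \<open>R\<close>, the images agree to the left of
  \<open>- int R\<close>, where only negative positions are seen. The positions where they differ
  are thus bounded below and have a least element.\<close>

lemma equivariant_first_difference:
  fixes X :: "(int \<Rightarrow> 'a::{finite,discrete_topology}) set"
  assumes X: "is_shift X" and f: "equivariant X f"
    and xy: "x \<in> X" "y \<in> X" "\<forall>i<0. x i = y i" and ne: "f x \<noteq> f y"
  shows "\<exists>m. (\<forall>i<m. f x i = f y i) \<and> f x m \<noteq> f y m"
proof -
  obtain R where R: "\<forall>x\<in>X. \<forall>y\<in>X. (\<forall>i\<in>{- int R..int R}. x i = y i) \<longrightarrow> f x 0 = f y 0"
    using equivariant_local[OF X f] by blast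
  have low: "f x i = f y i" if "i < - int R" for i
  proof -
    have "f (shift_by i x) 0 = f (shift_by i y) 0"
    proof -
      have "\<forall>j\<in>{- int R..int R}. shift_by i x j = shift_by i y j"
        using xy(3) that by (auto simp: shift_by_def)
      then show ?thesis using R shift_by_in[OF X] xy(1,2) by blast
    qed
    then show ?thesis
      unfolding equivariant_shift_by[OF X f xy(1)] equivariant_shift_by[OF X f xy(2)]
      by (simp add: shift_by_def)
  qed
  obtain d where d: "f x d \<noteq> f y d" using ne by auto
  \<comment> \<open>Counting from \<open>- int R\<close> makes the positions natural numbers, so
    that \<open>LEAST\<close> applies.\<close>
  let ?D = "\<lambda>n::nat. f x (- int R + int n) \<noteq> f y (- int R + int n)"
  have "d \<ge> - int R" using low d by force
  then have "?D (nat (d + int R))" using d by simp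
  then have "?D (LEAST n. ?D n)" by (rule LeastI)
  moreover have "f x i = f y i" if "i < - int R + int (LEAST n. ?D n)" for i
  proof (cases "i < - int R")
    case False
    then have "nat (i + int R) < (LEAST n. ?D n)" using that by linarith
    then show ?thesis using not_less_Least[of _ ?D] False by fastforce
  qed (rule low)
  ultimately show ?thesis by blast
qed

text \<open>
  Every limit point of the backward orbit of \<open>x\<close> is a point where \<open>f\<close> and \<open>g\<close> coincide, and so is
  every point of its forward orbit closure, which is \<open>X\<close>.
\<close>

lemma equivariant_eqI:
  fixes X :: "(int \<Rightarrow> 'a::{finite,discrete_topology}) set"
  assumes min: "minimal_shift X" and f: "equivariant X f" and g: "equivariant X g"
    and x: "x \<in> X" and eq: "\<forall>i<0. f x i = g x i" and y: "y \<in> X"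
  shows "f y = g y"
proof -
  have X: "is_shift X" and dense: "\<And>z. z \<in> X \<Longrightarrow> X \<subseteq> closure (orbit z)"
    using min by (auto simp: minimal_shift_def)
  have closed: "closed {z \<in> X. \<forall>i\<in>I. f z i = g z i}" for I
    using X f g by (intro closed_Collect_agree) (auto simp: is_shift_def equivariant_def)
  define C where "C n = {z \<in> X. \<forall>i\<in>{..<int n}. f z i = g z i}" for n
  have "X \<inter> (\<Inter>n. C n) \<noteq> {}"
  proof (rule compact_decseq_Inter_nonempty[OF is_shift_compact[OF X]])
    show "closed (C n)" for n
      unfolding C_def by (rule closed)
    show "decseq C"
      unfolding C_def by (intro decseq_SucI) auto
    show "X \<inter> C n \<noteq> {}" for n
    proof -
      \<comment> \<open>The backward shift by \<open>n\<close> carries agreement left of 0 to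
        agreement left of \<open>n\<close>.\<close>
      have "shift_by (- int n) x \<in> C n"
        unfolding C_def mem_Collect_eq equivariant_shift_by[OF X f x] equivariant_shift_by[OF X g x]
        using eq by (intro conjI shift_by_in[OF X x]) (simp add: shift_by_def)
      then show ?thesis by (auto simp: C_def)
    qed
  qed
  then obtain z where z: "z \<in> X" "\<And>n. z \<in> C n" by blast
  have "f z i = g z i" for i
    using z(2)[of "nat (i + 1)"] by (simp add: C_def)
  then have fz: "f z = g z" by auto
  have "orbit z \<subseteq> {z \<in> X. \<forall>i\<in>UNIV. f z i = g z i}"
    using shift_by_in[OF X z(1)] fz
    by (auto simp: orbit_def funpow_shift_map equivariant_shift_by[OF X f z(1)]
        equivariant_shift_by[OF X g z(1)])
  then have "closure (orbit z) \<subseteq> {z \<in> X. \<forall>i\<in>UNIV. f z i = g z i}"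
    using closed[of UNIV] by (rule closure_minimal)
  then have "y \<in> {z \<in> X. \<forall>i\<in>UNIV. f z i = g z i}"
    using dense[OF z(1)] y by blast
  then show ?thesis by (simp add: fun_eq_iff)
qed

text \<open>Pigeonhole: if no two maps were related, the \<open>k\<close> words before the first
  differences would be distinct for all large \<open>n\<close>, but for some such \<open>n\<close>
  fewer than \<open>k\<close> words are right special. Injectivity keeps the images of the
  asymptotic pair distinct.\<close>

lemma equivariant_maps_related:
  fixes X :: "(int \<Rightarrow> 'a::{finite,discrete_topology}) set"
  assumes min: "minimal_shift X" and inf: "infinite X"
    and liminf: "liminf (\<lambda>n. ereal (real (complexity X n) / real n)) < ereal (real k)"
    and F: "finite F" "card F = k" "\<And>f. f \<in> F \<Longrightarrow> equivariant X f \<and> inj_on f X"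
  shows "\<exists>f\<in>F. \<exists>g\<in>F. \<exists>m. f \<noteq> g \<and> (\<forall>x\<in>X. f x = shift_by m (g x))"
proof (rule ccontr)
  assume neg: "\<not> ?thesis"
  have X: "is_shift X" using min by (simp add: minimal_shift_def)
  have fX: "f x \<in> X" if "f \<in> F" "x \<in> X" for f x
    using F(3)[OF that(1)] that(2) by (auto simp: equivariant_def)
  obtain x y where xy: "x \<in> X" "y \<in> X" "\<forall>i<0. x i = y i" "x 0 \<noteq> y 0"
    using exists_left_asymptotic_pair[OF X inf] by blast
  have "\<exists>m. (\<forall>i<m. f x i = f y i) \<and> f x m \<noteq> f y m" if "f \<in> F" for f
  proof (rule equivariant_first_difference[OF X _ xy(1-3)])
    show "f x \<noteq> f y" using F(3)[OF that] xy by (auto dest: inj_onD)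
  qed (use F(3)[OF that] in simp)
  then obtain m where m: "\<And>f. f \<in> F \<Longrightarrow> \<forall>i<m f. f x i = f y i"
      "\<And>f. f \<in> F \<Longrightarrow> f x (m f) \<noteq> f y (m f)"
    by metis
  define w where "w n f = word (m f - int n) n (f x)" for n f
  have special: "w n ` F \<subseteq> right_special X n" for n
    unfolding w_def
  proof (rule image_subsetI)
    fix f assume f: "f \<in> F"
    show "word (m f - int n) n (f x) \<in> right_special X n"
      by (rule right_specialI[OF X fX[OF f xy(1)] fX[OF f xy(2)]]) (use m f in auto)
  qed
  have "eventually (\<lambda>n. inj_on (w n) F) sequentially"
  proof (rule eventually_inj_on[OF F(1)])
    fix f g assume fg: "f \<in> F" "g \<in> F" "f \<noteq> g"
    \<comment> \<open>Both images are moved so that their first differences lie at 0. Agreement left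
      of 0 would make \<open>f\<close> a shift of \<open>g\<close> on all of
      \<open>X\<close>.\<close>
    have "\<not> (\<forall>i<0. shift_by (m f) (f x) i = shift_by (m g) (g x) i)"
    proof
      assume "\<forall>i<0. shift_by (m f) (f x) i = shift_by (m g) (g x) i"
      then have "shift_by (m f) (f z) = shift_by (m g) (g z)" if "z \<in> X" for z
        using equivariant_eqI[OF min equivariant_shift_by_comp[OF X] equivariant_shift_by_comp[OF X]]
          F(3) fg xy(1) that by blast
      then have "shift_by (- m f) (shift_by (m f) (f z)) = shift_by (- m f) (shift_by (m g) (g z))"
        if "z \<in> X" for z using that by simp
      then have "\<forall>z\<in>X. f z = shift_by (m g - m f) (g z)" by simp
      then show False using neg fg by blast
    qed
    then obtain i where i: "i < 0" "f x (i + m f) \<noteq> g x (i + m g)"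
      by (auto simp: shift_by_def)
    \<comment> \<open>Position \<open>i\<close> relative to the first difference has index
      \<open>int n + i\<close> in the window, which is nonnegative once \<open>n\<close> is at least
      \<open>- i\<close>.\<close>
    have "w n f \<noteq> w n g" if "n \<ge> nat (- i)" for n
    proof
      assume "w n f = w n g"
      then have "\<forall>j<n. f x (m f - int n + int j) = g x (m g - int n + int j)"
        by (simp add: w_def word_eq_iff)
      moreover have "nat (int n + i) < n" "int (nat (int n + i)) = int n + i"
        using that i(1) by auto
      ultimately have "f x (m f - int n + (int n + i)) = g x (m g - int n + (int n + i))"
        by metis
      then show False using i(2) by (simp add: add.commute)
    qed
    then show "eventually (\<lambda>n. w n f \<noteq> w n g) sequentially"
      by (rule eventually_sequentiallyI)
  qed
  then obtain N where N: "\<And>n. n \<ge> N \<Longrightarrow> inj_on (w n) F"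
    by (auto simp: eventually_sequentially)
  obtain n where n: "n \<ge> N" "complexity X (Suc n) < complexity X n + k"
    using liminf_quotient_less_imp_increment_less[OF liminf] by blast
  have "card F \<le> card (right_special X n)"
    using N[OF n(1)] special finite_subset[OF right_special_subset finite_language]
    by (rule card_inj_on_le)
  then show False
    using n(2) card_right_special[of X n] F(2) by simp
qed

section \<open>The automorphism group modulo the shift\<close>

lemma Aut_equivariant:
  assumes "f \<in> carrier (Aut X)"
  shows "equivariant X f" "inj_on f X"
proof -
  obtain g where "homeomorphism X X f g"
    using assms by (auto simp: carrier_Aut)
  then show "equivariant X f" "inj_on f X"
    using assms by (auto simp: equivariant_def carrier_Aut homeomorphism_def intro: inj_on_inverseI)
qed

lemma restrict_shift_by_in_Aut:
  fixes X :: "(int \<Rightarrow> 'a::{finite,discrete_topology}) set"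
  assumes X: "is_shift X"
  shows "restrict (shift_by m) X \<in> carrier (Aut X)"
proof -
  have "shift_by n ` X \<subseteq> X" for n
    using shift_by_in[OF X] by blast
  then have "homeomorphism X X (shift_by m) (shift_by (- m))"
    by (intro homeomorphismI continuous_on_shift_by) auto
  then have "homeomorphism X X (restrict (shift_by m) X) (shift_by (- m))"
    by (rule homeomorphism_cong) auto
  then show ?thesis
    using shift_by_in[OF X] by (auto simp: carrier_Aut shift_map_eq_shift_by add.commute)
qed

text \<open>Connects the integers \<open>m\<close> of the related maps with the generated subgroup;
  negative powers come from the inverse of the generator.\<close>

lemma restrict_shift_by_in_shift_subgroup:
  fixes X :: "(int \<Rightarrow> 'a::{finite,discrete_topology}) set"
  assumes X: "is_shift X"
  shows "restrict (shift_by m) X \<in> shift_subgroup X"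
proof -
  interpret normal "shift_subgroup X" "Aut X" by (rule shift_subgroup_normal[OF X])
  note carrier = restrict_shift_by_in_Aut[OF X]
  have one: "restrict (shift_by 0) X = \<one>\<^bsub>Aut X\<^esub>"
    by (simp add: one_Aut restrict_def fun_eq_iff)
  have mult: "restrict (shift_by m) X \<otimes>\<^bsub>Aut X\<^esub> restrict (shift_by n) X = restrict (shift_by (m + n)) X"
    for m n
    using shift_by_in[OF X] by (auto simp: mult_Aut carrier compose_def fun_eq_iff)
  have s1: "restrict (shift_by 1) X \<in> shift_subgroup X"
    unfolding shift_subgroup_def shift_map_eq_shift_by by (rule generate.incl) simp
  have "inv\<^bsub>Aut X\<^esub> restrict (shift_by 1) X = restrict (shift_by (-1)) X"
    by (rule inv_equality) (simp_all add: mult one carrier)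
  then have s2: "restrict (shift_by (-1)) X \<in> shift_subgroup X"
    using m_inv_closed[OF s1] by simp
  show ?thesis
  proof (induction m rule: int_induct[where k = 0])
    case base
    then show ?case unfolding one by (rule subgroup.one_closed[OF is_subgroup])
  next
    case (step1 i)
    show ?case using subgroup.m_closed[OF is_subgroup step1(2) s1] unfolding mult .
  next
    case (step2 i)
    show ?case using subgroup.m_closed[OF is_subgroup step2(2) s2]
      unfolding mult diff_conv_add_uminus .
  qed
qed

text \<open>The relation makes \<open>f\<close> the product of a power of the shift and
  \<open>g\<close>; off \<open>X\<close> both sides are \<open>undefined\<close> by
  extensionality.\<close>

lemma shift_subgroup_coset_eqI:
  fixes X :: "(int \<Rightarrow> 'a::{finite,discrete_topology}) set"
  assumes X: "is_shift X" and fg: "f \<in> carrier (Aut X)" "g \<in> carrier (Aut X)"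
    and eq: "\<And>x. x \<in> X \<Longrightarrow> f x = shift_by m (g x)"
  shows "shift_subgroup X #>\<^bsub>Aut X\<^esub> f = shift_subgroup X #>\<^bsub>Aut X\<^esub> g"
proof -
  interpret normal "shift_subgroup X" "Aut X" by (rule shift_subgroup_normal[OF X])
  let ?s = "restrict (shift_by m) X"
  have s: "?s \<in> shift_subgroup X" by (rule restrict_shift_by_in_shift_subgroup[OF X])
  have "f = ?s \<otimes>\<^bsub>Aut X\<^esub> g"
  proof
    fix x
    show "f x = (?s \<otimes>\<^bsub>Aut X\<^esub> g) x"
      unfolding mult_Aut[OF mem_carrier[OF s] fg(2)]
      using fg eq Aut_equivariant(1)[OF fg(2)]
      by (cases "x \<in> X") (auto simp: compose_def carrier_Aut extensional_def equivariant_def)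
  qed
  then have "f \<in> shift_subgroup X #>\<^bsub>Aut X\<^esub> g"
    using s fg(2) subset by (auto intro: rcosI)
  then show ?thesis
    by (rule repr_independence[OF _ fg(2) is_subgroup, symmetric])
qed

lemma carrier_Aut_Mod:
  "carrier (Aut X Mod shift_subgroup X) =
    (\<lambda>f. shift_subgroup X #>\<^bsub>Aut X\<^esub> f) ` carrier (Aut X)"
  by (auto simp: FactGroup_def RCOSETS_def)

text \<open>The orbit of \<open>g x\<close> is finite, hence closed, so by minimality it contains
  \<open>f x\<close>. Then \<open>f\<close> and a shift of \<open>g\<close> agree at
  \<open>x\<close>, and therefore on \<open>X\<close>.\<close>

lemma finite_minimal_shift_card_le_1:
  fixes X :: "(int \<Rightarrow> 'a::{finite,discrete_topology}) set"
  assumes min: "minimal_shift X" and fin: "finite X"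
  shows "\<exists>c. carrier (Aut X Mod shift_subgroup X) \<subseteq> {c}"
proof -
  have X: "is_shift X" using min by (simp add: minimal_shift_def)
  have "shift_subgroup X #>\<^bsub>Aut X\<^esub> f = shift_subgroup X #>\<^bsub>Aut X\<^esub> g"
    if f: "f \<in> carrier (Aut X)" and g: "g \<in> carrier (Aut X)" for f g
  proof (cases "X = {}")
    case True
    then show ?thesis using f g by (intro shift_subgroup_coset_eqI[OF X]) auto
  next
    case False
    then obtain x where x: "x \<in> X" by blast
    note f' = Aut_equivariant(1)[OF f] and g' = Aut_equivariant(1)[OF g]
    have "g x \<in> X" "f x \<in> X" using x f' g' by (auto simp: equivariant_def)
    have "orbit (g x) \<subseteq> X"
      using shift_by_in[OF X \<open>g x \<in> X\<close>] by (auto simp: orbit_def funpow_shift_map)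
    then have "closed (orbit (g x))"
      using fin finite_subset by (blast intro: finite_imp_closed_fun)
    then have "f x \<in> orbit (g x)"
      using min \<open>g x \<in> X\<close> \<open>f x \<in> X\<close> unfolding minimal_shift_def by (metis closure_closed subsetD)
    then obtain n where "f x = shift_by (int n) (g x)"
      by (auto simp: orbit_def funpow_shift_map)
    then have "f y = shift_by (int n) (g y)" if "y \<in> X" for y
      using equivariant_eqI[OF min f' equivariant_shift_by_comp[OF X g'] x _ that] by simp
    then show ?thesis by (rule shift_subgroup_coset_eqI[OF X f g])
  qed
  then show ?thesis unfolding carrier_Aut_Mod by blast
qed

text \<open>For finite \<open>X\<close> the lower limit is 0 and the quotient has one element, so
  the strict bound would fail at \<open>k = 1\<close>; the last hypothesis excludes exactly this
  case.\<close>

theorem theorem1p4: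
  fixes X :: "(int \<Rightarrow> 'a::{finite,discrete_topology}) set" and k :: nat
  assumes "minimal_shift X"
    and "liminf (\<lambda>n. ereal (real (complexity X n) / real n)) < ereal (real k)"
    and "k = 1 \<longrightarrow> infinite X"
  shows "finite (carrier (Aut X Mod shift_subgroup X))
    \<and> card (carrier (Aut X Mod shift_subgroup X)) < k"
proof (cases "finite X")
  case True
  obtain c where c: "carrier (Aut X Mod shift_subgroup X) \<subseteq> {c}"
    using finite_minimal_shift_card_le_1[OF assms(1) True] by blast
  \<comment> \<open>For \<open>k = 0\<close> the complexity would have to decrease somewhere, but it
    is monotone.\<close>
  have "k \<noteq> 0"
    using liminf_quotient_less_imp_increment_less[OF assms(2), of 0] card_right_special[of X]
    by (metis add_leD2 add_0_right not_less)
  moreover have "k \<noteq> 1" using True assms(3) by blast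
  ultimately have "k \<ge> 2" by linarith
  moreover have "card (carrier (Aut X Mod shift_subgroup X)) \<le> 1"
    using card_mono[OF _ c] by simp
  ultimately show ?thesis
    using finite_subset[OF c] by simp
next
  case False
  let ?c = "\<lambda>f. shift_subgroup X #>\<^bsub>Aut X\<^esub> f"
  have X: "is_shift X" using assms(1) by (simp add: minimal_shift_def)
  show ?thesis
  proof (rule ccontr)
    assume "\<not> ?thesis"
    \<comment> \<open>An infinite quotient and a finite one with at least \<open>k\<close> elements
      both contain exactly \<open>k\<close> cosets to choose.\<close>
    then have "\<exists>S. S \<subseteq> ?c ` carrier (Aut X) \<and> finite S \<and> card S = k"
      unfolding carrier_Aut_Mod
      by (metis infinite_arbitrarily_large not_less obtain_subset_with_card_n)
    then obtain S where S: "S \<subseteq> ?c ` carrier (Aut X)" "finite S" "card S = k" by blast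
    \<comment> \<open>\<open>F\<close> holds one representative of each chosen coset.\<close>
    then obtain F where F: "F \<subseteq> carrier (Aut X)" "inj_on ?c F" "S = ?c ` F"
      by (auto simp: subset_image_inj)
    have "finite F" "card F = k"
      using S F finite_imageD card_image by (metis, metis)
    moreover have "equivariant X f \<and> inj_on f X" if "f \<in> F" for f
      using Aut_equivariant F(1) that by blast
    ultimately obtain f g m
      where fg: "f \<in> F" "g \<in> F" "f \<noteq> g" "\<And>x. x \<in> X \<Longrightarrow> f x = shift_by m (g x)"
      using equivariant_maps_related[OF assms(1) False assms(2), of F] by blast
    then have "?c f = ?c g"
      using F(1) by (intro shift_subgroup_coset_eqI[OF X]) auto
    then show False using fg F(2) by (auto dest: inj_onD)
  qed
qed

end
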